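(* Let $g=(x,t)\in N_{3,2}$ with $x\ne0$ and $t=0$. Then $$p_h(x,t)=\mathbf C\,4\pi\,\mathbf F(0,0)\,h^{-7/2}\,|x|^{-2}\,e^{-\frac{d(g)^2}{4h}}\,(1+o_g(1))\qquad\text{as }h\to0^+,$$ where $o_g(1)\to0$ as $h\to0^+$ for fixed $g$.
   Context: $N_{3,2}=\mathbb R^3\times\mathbb R^3$ with $(x,t)\cdot(x',t')=(x+x',\,t+t'-\tfrac12x\times x')$ ($\times$ = cross product). Left-invariant fields: $X_1=\partial_{x_1}-\tfrac12x_3\partial_{t_2}+\tfrac12x_2\partial_{t_3}$, $X_2=\partial_{x_2}+\tfrac12x_3\partial_{t_1}-\tfrac12x_1\partial_{t_3}$, $X_3=\partial_{x_3}-\tfrac12x_2\partial_{t_1}+\tfrac12x_1\partial_{t_2}$; $\Delta=X_1^2+X_2^2+X_3^2$. $d(g)$ is the Carnot--Carathéodory distance from the identity to $g$ (infimum of lengths of horizontal curves, $X_1,X_2,X_3$ orthonormal). The heat kernel of $\partial_h-\Delta$ (with respect to Lebesgue measure) is $p_h(x,t)=\mathbf C\,h^{-9/2}\,p(x/\sqrt h,t/h)$ with a positive (normalizing) constant $\mathbf C$ and $$p(x,t)=\int_{\mathbb R^3}\frac{|\lambda|}{\sinh|\lambda|}\exp\Big\{-\tfrac14\Big[|x|^2+\tfrac{|\lambda|\coth|\lambda|-1}{|\lambda|^2}\big(|\lambda|^2|x|^2-(\lambda\cdot x)^2\big)-4i\,t\cdot\lambda\Big]\Big\}d\lambda .$$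 $\mathbf F(v_1,v_2)=\int_{\mathbb R}\frac{r^3}{r\cosh r-\sinh r}\,e^{-\frac14\frac{r^2}{r\coth r-1}v_1^2+iv_2r}\,dr$ for $v_1,v_2\in\mathbb R$. *)

theory Defs
  imports "HOL-Analysis.Analysis"
begin

section \<open>The group and its left-invariant fields\<close>

type_synonym n32 = "(real^3) \<times> (real^3)"

definition n32_mult :: "n32 \<Rightarrow> n32 \<Rightarrow> n32" where
  "n32_mult g g' = (fst g + fst g', snd g + snd g' - (1/2) *\<^sub>R cross3 (fst g) (fst g'))"

definition X1 :: "n32 \<Rightarrow> n32" where
  "X1 g = (let x = fst g in (vector [1, 0, 0], vector [0, - x$3 / 2, x$2 / 2]))"

definition X2 :: "n32 \<Rightarrow> n32" where
  "X2 g = (let x = fst g in (vector [0, 1, 0], vector [x$3 / 2, 0, - x$1 / 2]))"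

definition X3 :: "n32 \<Rightarrow> n32" where
  "X3 g = (let x = fst g in (vector [0, 0, 1], vector [- x$2 / 2, x$1 / 2, 0]))"

text \<open>The group law is not used below; the next lemma ties the coordinate formulas for the
  fields to it: the horizontal direction with coordinates \<open>u\<close> at \<open>g\<close> is the velocity at
  \<open>s = 0\<close> of \<open>s \<mapsto> g \<cdot> (s u, 0)\<close>.\<close>

lemma n32_mult_velocity:
  "((\<lambda>s. n32_mult g (s *\<^sub>R u, 0)) has_vector_derivative
      (u$1 *\<^sub>R X1 g + u$2 *\<^sub>R X2 g + u$3 *\<^sub>R X3 g)) (at 0)"
proof -
  have eq: "u$1 *\<^sub>R X1 g + u$2 *\<^sub>R X2 g + u$3 *\<^sub>R X3 g = (u, - ((1/2) *\<^sub>R cross3 (fst g) u))"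
    by (simp add: X1_def X2_def X3_def Let_def prod_eq_iff cross3_def vec_eq_iff forall_3
        vector_3 field_simps)
  have mult: "n32_mult g (s *\<^sub>R u, 0) = g + s *\<^sub>R (u, - ((1/2) *\<^sub>R cross3 (fst g) u))" for s
    by (simp add: n32_mult_def prod_eq_iff cross_mult_right)
  show ?thesis
    unfolding eq mult by (auto intro!: derivative_eq_intros)
qed


section \<open>The Carnot--Caratheodory distance\<close>

definition abs_continuous_on :: "real \<Rightarrow> real \<Rightarrow> (real \<Rightarrow> 'a::real_normed_vector) \<Rightarrow> bool" where
  "abs_continuous_on a b f \<longleftrightarrow>
     (\<forall>\<epsilon>>0. \<exists>\<delta>>0. \<forall>D T. D division_of T \<and> T \<subseteq> {a..b} \<and> (\<Sum>K\<in>D. measure lborel K) < \<delta> \<longrightarrow>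
        (\<Sum>K\<in>D. norm (f (Sup K) - f (Inf K))) < \<epsilon>)"

text \<open>The control \<open>u\<close> consists of the coordinates of the velocity of \<open>\<gamma>\<close> in the frame
  \<open>X1, X2, X3\<close>. It is determined almost everywhere by \<open>\<gamma>\<close>, and its integrability follows from
  the absolute continuity of \<open>\<gamma>\<close>; requiring it keeps the default value of a
  non-existing integral out of the definition of length.\<close>

definition horizontal_curve :: "(real \<Rightarrow> n32) \<Rightarrow> (real \<Rightarrow> real^3) \<Rightarrow> bool" where
  "horizontal_curve \<gamma> u \<longleftrightarrow>
     abs_continuous_on 0 1 \<gamma> \<and>
     u absolutely_integrable_on {0..1} \<and>
     (AE s in lebesgue. s \<in> {0..1} \<longrightarrow>
        (\<gamma> has_vector_derivative
          (u s $ 1 *\<^sub>R X1 (\<gamma> s) + u s $ 2 *\<^sub>R X2 (\<gamma> s) + u s $ 3 *\<^sub>R X3 (\<gamma> s)))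
        (at s within {0..1}))"

text \<open>As the frame is orthonormal, the speed of the curve is the Euclidean norm of \<open>u\<close>.\<close>

definition horizontal_length :: "(real \<Rightarrow> real^3) \<Rightarrow> real" where
  "horizontal_length u = integral {0..1} (\<lambda>s. norm (u s))"

definition cc_dist :: "n32 \<Rightarrow> real" where
  "cc_dist g = Inf {horizontal_length u | \<gamma> u. horizontal_curve \<gamma> u \<and> \<gamma> 0 = (0, 0) \<and> \<gamma> 1 = g}"


section \<open>The heat kernel\<close>

definition coth :: "real \<Rightarrow> real" where
  "coth r = cosh r / sinh r"

text \<open>The integrands below have removable singularities at the origin, where division by zero
  gives an irrelevant value on a null set.\<close>

definition heat_p :: "real^3 \<Rightarrow> real^3 \<Rightarrow> complex" where
  "heat_p x t =
     (LINT l|lborel.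
        complex_of_real (norm l / sinh (norm l)) *
        exp (- (1/4) *
          (complex_of_real ((norm x)\<^sup>2 +
             (norm l * coth (norm l) - 1) / (norm l)\<^sup>2 *
             ((norm l)\<^sup>2 * (norm x)\<^sup>2 - (l \<bullet> x)\<^sup>2))
           - 4 * \<i> * complex_of_real (t \<bullet> l))))"

text \<open>The kernel of \<open>\<partial>\<^sub>h - (X1\<^sup>2 + X2\<^sup>2 + X3\<^sup>2)\<close> with respect to Lebesgue measure, through its
  integral formula; the positive constant \<open>C\<close> is a parameter.\<close>

definition heat_kernel :: "real \<Rightarrow> real \<Rightarrow> real^3 \<Rightarrow> real^3 \<Rightarrow> complex" where
  "heat_kernel C h x t =
     complex_of_real (C * h powr (- 9/2)) * heat_p ((1 / sqrt h) *\<^sub>R x) ((1 / h) *\<^sub>R t)"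

definition bold_F :: "real \<Rightarrow> real \<Rightarrow> complex" where
  "bold_F v1 v2 =
     (LINT r|lborel.
        complex_of_real (r ^ 3 / (r * cosh r - sinh r)) *
        exp (complex_of_real (- (1/4) * (r\<^sup>2 / (r * coth r - 1)) * v1\<^sup>2)
             + \<i> * complex_of_real (v2 * r)))"

end

theory Submission
  imports Defs "HOL-Probability.Sinc_Integral"
begin

text \<open>For \<open>t = 0\<close> the distance is \<open>|x|\<close>: the first component of a horizontal curve is a curve in
  Euclidean space with velocity \<open>u\<close>, so its length is at least \<open>|x|\<close>, and the segment from \<open>0\<close> to
  \<open>x\<close> is horizontal. The factor \<open>exp (- |x|^2 / (4 h))\<close> splits off the integral, and the remaining
  exponent is a negative multiple of \<open>|m|^2 / h\<close>, where \<open>m\<close> is the part of \<open>\<lambda>\<close> orthogonal to \<open>x\<close>.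
  Rescaling \<open>m\<close> by \<open>sqrt h\<close> gives a Jacobian \<open>h\<close> and an integrand that converges, as \<open>h\<close> tends to
  \<open>0\<close>, to a Gaussian in \<open>m\<close> whose width depends on the component \<open>r\<close> of \<open>\<lambda>\<close> along \<open>x\<close>. By dominated
  convergence the limit may be integrated in \<open>m\<close> first, which leaves the integral over \<open>r\<close> that
  defines \<open>F(0,0)\<close>.\<close>

section \<open>Distance to horizontal points\<close>

text \<open>A gauge-integral argument. Intervals tagged where the derivative exists are handled by
  differentiability, those tagged in the null set by absolute continuity. Each group costs at most
  half of the admissible error.\<close>

lemma has_integral_deriv_abs_continuous:
  fixes f :: "real \<Rightarrow> 'a::banach"
  assumes "a \<le> b" and ac: "abs_continuous_on a b f" and N: "negligible N"
    and deriv: "\<And>s. s \<in> {a..b} - N \<Longrightarrow> (f has_vector_derivative f' s) (at s within {a..b})"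
  shows "(f' has_integral (f b - f a)) {a..b}"
proof (cases "a = b")
  case True
  then show ?thesis by auto
next
  case False
  with \<open>a \<le> b\<close> have "a < b" by simp
  \<comment> \<open>With value 0 on \<open>N\<close>, intervals tagged in \<open>N\<close>
    contribute nothing to the Riemann sum, so their error is just the increment of
    \<open>f\<close>.\<close>
  define g where "g s = (if s \<in> N then 0 else f' s)" for s
  have "(g has_integral (f b - f a)) {a..b}"
    unfolding has_integral_factor_content box_real[symmetric]
  proof (intro allI impI)
    fix e :: real
    assume "e > 0"
    then have "\<forall>s. \<exists>d>0. s \<in> {a..b} - N \<longrightarrow>
        (\<forall>y\<in>{a..b}. norm (y - s) < d \<longrightarrow> norm (f y - f s - (y - s) *\<^sub>R f' s) \<le> e/2 * norm (y - s))"
      using deriv[unfolded has_vector_derivative_def has_derivative_within_alt]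
      using half_gt_zero[OF \<open>e > 0\<close>] by blast
    then obtain d where d: "\<And>s. 0 < d s"
      "\<And>s y. \<lbrakk>s \<in> {a..b} - N; y \<in> {a..b}; norm (y - s) < d s\<rbrakk>
          \<Longrightarrow> norm (f y - f s - (y - s) *\<^sub>R f' s) \<le> e/2 * norm (y - s)"
      by metis
    \<comment> \<open>Half of the error budget \<open>e * (b - a)\<close>. It is positive because
      the degenerate interval was treated separately.\<close>
    have "e/2 * (b - a) > 0" using \<open>e > 0\<close> \<open>a < b\<close> by simp
    then obtain \<delta> where "\<delta> > 0" and \<delta>: "\<And>D T. D division_of T \<Longrightarrow> T \<subseteq> {a..b} \<Longrightarrow>
        (\<Sum>K\<in>D. measure lborel K) < \<delta> \<Longrightarrow> (\<Sum>K\<in>D. norm (f (Sup K) - f (Inf K))) < e/2 * (b - a)"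
      using ac unfolding abs_continuous_on_def by meson
    have Nm: "N \<in> sets lebesgue" "measure lebesgue N = 0" "N \<in> lmeasurable"
      using N by (auto simp: negligible_iff_measure)
    obtain U where U: "open U" "N \<subseteq> U" "U - N \<in> lmeasurable" "emeasure lebesgue (U - N) < \<delta>"
      using sets_lebesgue_outer_open[OF Nm(1) \<open>\<delta> > 0\<close>] by metis
    have "U = (U - N) \<union> N" using U(2) by auto
    then have Um: "U \<in> lmeasurable"
      using U(3) Nm(3) by (metis fmeasurable.Un)
    have mU: "measure lebesgue U < \<delta>"
    proof -
      have "measure lebesgue U = measure lebesgue (U - N)"
        by (metis \<open>U = (U - N) \<union> N\<close> N measure_Un_null_set U(3) fmeasurableD negligible_iff_null_sets)
      also have "\<dots> < \<delta>"
        using U(3,4) \<open>\<delta> > 0\<close> by (simp add: emeasure_eq_measure2 ennreal_less_iff)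
      finally show ?thesis .
    qed
    \<comment> \<open>Intervals tagged in the null set stay inside the small open set \<open>U\<close>, where absolute
      continuity bounds the increments; on all others the derivative does.\<close>
    define G where "G s = (if s \<in> N then U else ball s (d s))" for s
    have "gauge G"
      using U(1,2) d(1) by (auto simp: gauge_def G_def)
    moreover have "norm ((\<Sum>(s, K)\<in>p. measure lborel K *\<^sub>R g s) - (f b - f a)) \<le> e * measure lborel (cbox a b)"
      if ptag: "p tagged_division_of cbox a b" and fine: "G fine p" for p
    proof -
      have "finite p" using ptag by blast
      have fba: "b - a = (\<Sum>(s,K)\<in>p. Sup K - Inf K)" "f b - f a = (\<Sum>(s,K)\<in>p. f (Sup K) - f (Inf K))"
        using additive_tagged_division_1[where f= "\<lambda>x. x"] additive_tagged_division_1[where f= f]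
          \<open>a \<le> b\<close> ptag by auto
      define p2 where "p2 = {(s, K) \<in> p. s \<in> N}"
      have "p2 \<subseteq> p" by (auto simp: p2_def)
      have part: "p2 tagged_division_of \<Union>(snd ` p2)"
        by (rule tagged_partial_division_of_Union_self[OF
              tagged_partial_division_subset[OF conjunct1[OF ptag[unfolded tagged_division_of_def]] \<open>p2 \<subseteq> p\<close>]])
      have sub: "\<Union>(snd ` p2) \<subseteq> {a..b}"
        using tagged_division_ofD(3)[OF ptag] \<open>p2 \<subseteq> p\<close> by force
      have subU: "\<Union>(snd ` p2) \<subseteq> U"
        using fine unfolding p2_def fine_def G_def by fastforce
      have div: "snd ` p2 division_of \<Union>(snd ` p2)"
        by (rule division_of_tagged_division[OF part])
      have "(\<Sum>K\<in>snd ` p2. measure lborel K) = (\<Sum>K\<in>snd ` p2. measure lebesgue K)"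
        using div by (intro sum.cong) (auto elim!: division_ofD(4)[OF div])
      also have "\<dots> = measure lebesgue (\<Union>(snd ` p2))"
        by (rule content_division[OF div])
      also have "\<dots> \<le> measure lebesgue U"
        by (rule measure_mono_fmeasurable[OF subU _ Um]) (use lmeasurable_division[OF div] in auto)
      finally have "(\<Sum>K\<in>snd ` p2. measure lborel K) < \<delta>"
        using mU by linarith
      then have "(\<Sum>K\<in>snd ` p2. norm (f (Sup K) - f (Inf K))) < e/2 * (b - a)"
        by (rule \<delta>[OF div sub])
      \<comment> \<open>Forgetting tags could merge summands. But an interval occurring with two
        different tags has empty interior, so it is a single point and its increment is 0.\<close>
      also have "(\<Sum>K\<in>snd ` p2. norm (f (Sup K) - f (Inf K)))
          = (\<Sum>(s,K)\<in>p2. norm (f (Sup K) - f (Inf K)))"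
        unfolding split_def
      proof (subst sum.reindex_nontrivial)
        show "finite p2" using \<open>finite p\<close> \<open>p2 \<subseteq> p\<close> by (rule finite_subset[rotated])
        fix y z assume yz: "y \<in> p2" "z \<in> p2" "y \<noteq> z" "snd y = snd z"
        obtain s K where y: "y = (s, K)" by fastforce
        obtain s' where z: "z = (s', K)" using yz(4) y by (cases z) auto
        have p: "(s, K) \<in> p" "(s', K) \<in> p" "s \<noteq> s'"
          using yz \<open>p2 \<subseteq> p\<close> by (auto simp: y z)
        then have "interior K = {}"
          using tagged_division_ofD(5)[OF ptag p(1,2)] by simp
        moreover obtain u v where k: "K = cbox u v" "s \<in> K"
          using tagged_division_ofD(2,4)[OF ptag p(1)] by metis
        ultimately have "u = v"
          by auto
        then show "norm (f (Sup (snd y)) - f (Inf (snd y))) = 0"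
          by (simp add: y k)
      qed simp
      finally have bad: "(\<Sum>(s,K)\<in>p2. norm (f (Sup K) - f (Inf K))) \<le> e/2 * (b - a)"
        by simp
      have good: "norm (measure lborel K *\<^sub>R g s - (f (Sup K) - f (Inf K))) \<le> e/2 * (Sup K - Inf K)"
        if sK: "(s, K) \<in> p - p2" for s K
      proof -
        have "(s,K) \<in> p" and sN: "s \<notin> N" using sK by (auto simp: p2_def)
        then obtain u v where k: "K = cbox u v" and "s \<in> K" and kab: "K \<subseteq> cbox a b"
          using tagged_division_ofD(2-4)[OF ptag] by metis
        have "u \<le> v" using \<open>s \<in> K\<close> unfolding k by auto
        have ball: "\<And>y. y \<in> K \<Longrightarrow> norm (y - s) < d s"
          using fine \<open>(s, K) \<in> p\<close> sN unfolding fine_def G_def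
          by (fastforce simp: dist_norm norm_minus_commute)
        have "u \<in> K" "v \<in> K" by (simp_all add: \<open>u \<le> v\<close> k)
        have "s \<in> {a..b} - N" "u \<in> {a..b}" "v \<in> {a..b}"
          using \<open>s \<in> K\<close> \<open>u \<in> K\<close> \<open>v \<in> K\<close> kab sN by auto
        note D = d(2)[OF this(1) this(2) ball[OF \<open>u \<in> K\<close>]] d(2)[OF this(1) this(3) ball[OF \<open>v \<in> K\<close>]]
        \<comment> \<open>The derivative estimate is used at both endpoints. As \<open>s\<close>
          lies between \<open>u\<close> and \<open>v\<close>, the two errors add up to a multiple of
          the length \<open>v - u\<close>.\<close>
        have "norm ((v - u) *\<^sub>R f' s - (f v - f u))
            = norm ((f u - f s - (u - s) *\<^sub>R f' s) - (f v - f s - (v - s) *\<^sub>R f' s))"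
          by (auto simp: algebra_simps)
        also have "\<dots> \<le> e/2 * norm (u - s) + e/2 * norm (v - s)"
          using norm_triangle_ineq4 D by (smt (verit))
        also have "\<dots> = e/2 * (v - u)"
          using \<open>s \<in> K\<close> by (auto simp: k field_simps)
        finally show ?thesis
          using \<open>u \<le> v\<close> sN by (simp add: k g_def)
      qed
      have "norm ((\<Sum>(s, K)\<in>p. measure lborel K *\<^sub>R g s) - (f b - f a))
          = norm (\<Sum>(s,K)\<in>p. measure lborel K *\<^sub>R g s - (f (Sup K) - f (Inf K)))"
        by (simp add: fba split_def sum_subtractf)
      also have "\<dots> \<le> (\<Sum>(s,K)\<in>p. norm (measure lborel K *\<^sub>R g s - (f (Sup K) - f (Inf K))))"
        by (simp add: split_def norm_sum)
      also have "\<dots> = (\<Sum>(s,K)\<in>p2. norm (measure lborel K *\<^sub>R g s - (f (Sup K) - f (Inf K))))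
          + (\<Sum>(s,K)\<in>p - p2. norm (measure lborel K *\<^sub>R g s - (f (Sup K) - f (Inf K))))"
        using sum.subset_diff[OF \<open>p2 \<subseteq> p\<close> \<open>finite p\<close>] by (simp add: add.commute)
      also have "(\<Sum>(s,K)\<in>p2. norm (measure lborel K *\<^sub>R g s - (f (Sup K) - f (Inf K))))
          = (\<Sum>(s,K)\<in>p2. norm (f (Sup K) - f (Inf K)))"
        by (intro sum.cong) (auto simp: p2_def g_def norm_minus_commute)
      also have "(\<Sum>(s,K)\<in>p - p2. norm (measure lborel K *\<^sub>R g s - (f (Sup K) - f (Inf K))))
          \<le> (\<Sum>(s,K)\<in>p - p2. e/2 * (Sup K - Inf K))"
        by (intro sum_mono) (use good in auto)
      also have "\<dots> \<le> (\<Sum>(s,K)\<in>p. e/2 * (Sup K - Inf K))"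
      proof (rule sum_mono2[OF \<open>finite p\<close>])
        fix z assume "z \<in> p - (p - p2)"
        then obtain s K where z: "z = (s, K)" "(s, K) \<in> p" by (cases z) auto
        then obtain u v where k: "K = cbox u v" and "s \<in> K"
          using tagged_division_ofD(2,4)[OF ptag] by metis
        then show "0 \<le> (case z of (s, K) \<Rightarrow> e/2 * (Sup K - Inf K))"
          using z \<open>e > 0\<close> by auto
      qed auto
      also have "\<dots> = e/2 * (b - a)"
        by (simp add: fba(1) sum_distrib_left split_def)
      finally show ?thesis
        using bad \<open>a \<le> b\<close> by simp
    qed
    ultimately show "\<exists>d. gauge d \<and> (\<forall>p. p tagged_division_of cbox a b \<and> d fine p \<longrightarrow>
        norm ((\<Sum>(s, K)\<in>p. measure lborel K *\<^sub>R g s) - (f b - f a)) \<le> e * measure lborel (cbox a b))"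
      by (intro exI[of _ G] conjI allI impI) (simp_all only:)
  qed
  then show ?thesis
    by (rule has_integral_spike[OF N, rotated]) (auto simp: g_def)
qed

lemma lipschitz_imp_abs_continuous_on:
  assumes lip: "\<And>s t. norm (f s - f t) \<le> B * \<bar>s - t\<bar>"
  shows "abs_continuous_on a b f"
  unfolding abs_continuous_on_def
proof (intro allI impI)
  fix e :: real assume "e > 0"
  have "B \<ge> 0" using order_trans[OF norm_ge_zero lip[of 1 0]] by simp
  show "\<exists>\<delta>>0. \<forall>D T. D division_of T \<and> T \<subseteq> {a..b} \<and> (\<Sum>K\<in>D. measure lborel K) < \<delta> \<longrightarrow>
        (\<Sum>K\<in>D. norm (f (Sup K) - f (Inf K))) < e"
  \<comment> \<open>The summand 1 keeps the quotient meaningful when \<open>B = 0\<close>.\<close>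
  proof (intro exI[of _ "e / (B + 1)"] conjI allI impI)
    show "e / (B + 1) > 0" using \<open>e > 0\<close> \<open>B \<ge> 0\<close> by simp
    fix D and T :: "real set"
    assume *: "D division_of T \<and> T \<subseteq> {a..b} \<and> (\<Sum>K\<in>D. measure lborel K) < e / (B + 1)"
    have "(\<Sum>K\<in>D. norm (f (Sup K) - f (Inf K))) \<le> (\<Sum>K\<in>D. B * measure lborel K)"
    proof (rule sum_mono)
      fix K assume "K \<in> D"
      then obtain u v where "K = cbox u v" "K \<noteq> {}"
        using division_ofD(3,4)[OF conjunct1[OF *]] by metis
      then show "norm (f (Sup K) - f (Inf K)) \<le> B * measure lborel K"
        using lip[of v u] by auto
    qed
    also have "\<dots> \<le> (B + 1) * (\<Sum>K\<in>D. measure lborel K)"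
      by (simp add: sum_distrib_left sum_mono mult_right_mono)
    also have "\<dots> < e"
      using * \<open>B \<ge> 0\<close> by (simp add: field_simps)
    finally show "(\<Sum>K\<in>D. norm (f (Sup K) - f (Inf K))) < e" .
  qed
qed

lemma abs_continuous_on_fst:
  assumes "abs_continuous_on a b f"
  shows "abs_continuous_on a b (\<lambda>s. fst (f s))"
  unfolding abs_continuous_on_def
proof (intro allI impI)
  fix e :: real assume "e > 0"
  then obtain \<delta> where "\<delta> > 0" and \<delta>: "\<And>D T. D division_of T \<Longrightarrow> T \<subseteq> {a..b} \<Longrightarrow>
        (\<Sum>K\<in>D. measure lborel K) < \<delta> \<Longrightarrow> (\<Sum>K\<in>D. norm (f (Sup K) - f (Inf K))) < e"
    using assms unfolding abs_continuous_on_def by meson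
  have "(\<Sum>K\<in>D. norm (fst (f (Sup K)) - fst (f (Inf K)))) \<le> (\<Sum>K\<in>D. norm (f (Sup K) - f (Inf K)))" for D
    by (intro sum_mono) (metis fst_diff norm_fst_le prod.collapse)
  then show "\<exists>\<delta>>0. \<forall>D T. D division_of T \<and> T \<subseteq> {a..b} \<and> (\<Sum>K\<in>D. measure lborel K) < \<delta> \<longrightarrow>
        (\<Sum>K\<in>D. norm (fst (f (Sup K)) - fst (f (Inf K)))) < e"
    using \<open>\<delta> > 0\<close> \<delta> by (meson le_less_trans)
qed

section \<open>Horizontal curves and Euclidean length\<close>

text \<open>In this form the first component of a horizontal velocity is visibly the control
  itself.\<close>

lemma frame_combination:
  "u$1 *\<^sub>R X1 g + u$2 *\<^sub>R X2 g + u$3 *\<^sub>R X3 g = (u, - ((1/2) *\<^sub>R cross3 (fst g) u))"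
  by (simp add: X1_def X2_def X3_def Let_def prod_eq_iff cross3_def vec_eq_iff forall_3 field_simps)

lemma norm_le_horizontal_length:
  assumes hor: "horizontal_curve \<gamma> u" and "\<gamma> 0 = (0, 0)" and "\<gamma> 1 = (x, t)"
  shows "norm x \<le> horizontal_length u"
proof -
  have ac: "abs_continuous_on 0 1 \<gamma>" and u: "u absolutely_integrable_on {0..1}"
    and ae: "AE s in lebesgue. s \<in> {0..1} \<longrightarrow> (\<gamma> has_vector_derivative
          (u s, - ((1/2) *\<^sub>R cross3 (fst (\<gamma> s)) (u s)))) (at s within {0..1})"
    using hor unfolding horizontal_curve_def frame_combination by auto
  from ae obtain N where N: "negligible N" and "\<And>s. s \<in> {0..1} - N \<Longrightarrow> (\<gamma> has_vector_derivative
          (u s, - ((1/2) *\<^sub>R cross3 (fst (\<gamma> s)) (u s)))) (at s within {0..1})"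
    unfolding eventually_ae_filter_negligible by blast
  then have "((\<lambda>s. fst (\<gamma> s)) has_vector_derivative u s) (at s within {0..1})"
    if "s \<in> {0..1} - N" for s
    using that bounded_linear.has_vector_derivative[OF bounded_linear_fst] by fastforce
  with N have "(u has_integral (fst (\<gamma> 1) - fst (\<gamma> 0))) {0..1}"
    by (intro has_integral_deriv_abs_continuous abs_continuous_on_fst ac) auto
  then have "integral {0..1} u = x"
    using assms by (auto dest: integral_unique)
  moreover have "u integrable_on {0..1}" "(\<lambda>s. norm (u s)) integrable_on {0..1}"
    using u unfolding absolutely_integrable_on_def by blast+
  then have "norm (integral {0..1} u) \<le> integral {0..1} (\<lambda>s. norm (u s))"
    by (rule integral_norm_bound_integral) simp
  ultimately show ?thesis
    by (simp add: horizontal_length_def)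
qed

text \<open>The infimum is attained by the straight segment. Its vertical velocity is a multiple of
  the cross product of \<open>x\<close> with itself, hence zero.\<close>

lemma cc_dist_horizontal: "cc_dist (x, 0) = norm x"
  unfolding cc_dist_def
proof (rule cInf_eq_minimum)
  have "horizontal_curve (\<lambda>s. (s *\<^sub>R x, 0)) (\<lambda>_. x)"
    unfolding horizontal_curve_def frame_combination
  proof (intro conjI AE_I2 impI)
    show "abs_continuous_on 0 1 (\<lambda>s. (s *\<^sub>R x, 0 :: real^3))"
      by (rule lipschitz_imp_abs_continuous_on[where B="norm x"])
        (simp add: norm_Pair flip: scaleR_left_diff_distrib)
    show "((\<lambda>s. (s *\<^sub>R x, 0)) has_vector_derivative
        (x, - ((1/2) *\<^sub>R cross3 (fst (s *\<^sub>R x, 0 :: real^3)) x))) (at s within {0..1})" for s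
      by (auto intro!: derivative_eq_intros simp: cross_mult_left)
  qed auto
  moreover have "norm x = horizontal_length (\<lambda>_. x)"
    by (simp add: horizontal_length_def)
  ultimately show "norm x \<in> {horizontal_length u |\<gamma> u. horizontal_curve \<gamma> u \<and> \<gamma> 0 = (0, 0) \<and> \<gamma> 1 = (x, 0)}"
    by force
qed (auto intro: norm_le_horizontal_length)

section \<open>Lebesgue measure on three-space\<close>

lemma borel_measurable_orthogonal_transformation:
  fixes T :: "'a::euclidean_space \<Rightarrow> 'a"
  assumes "orthogonal_transformation T"
  shows "T \<in> borel_measurable borel"
  using assms by (intro borel_measurable_continuous_onI linear_continuous_on)
    (simp add: linear_conv_bounded_linear[symmetric] orthogonal_transformation_linear)

text \<open>Lebesgue measure is determined by its values on boxes. The preimage of a box under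
  \<open>T\<close> is its image under the orthogonal map \<open>inv T\<close>, which preserves
  measure.\<close>

lemma lborel_distr_orthogonal_transformation:
  fixes T :: "real^'n::{finite,wellorder} \<Rightarrow> real^'n::_"
  assumes T: "orthogonal_transformation T"
  shows "distr lborel borel T = lborel"
proof (rule lborel_eqI[symmetric])
  have [measurable]: "T \<in> borel_measurable borel"
    by (rule borel_measurable_orthogonal_transformation[OF T])
  have bij: "bij T" and invT: "orthogonal_transformation (inv T)"
    using T by (auto intro: orthogonal_transformation_bij orthogonal_transformation_inv)
  fix l u :: "real^'n::_"
  assume "\<And>b. b \<in> Basis \<Longrightarrow> l \<bullet> b \<le> u \<bullet> b"
  have "box l u \<in> lmeasurable" by simp
  then have m: "inv T ` box l u \<in> lmeasurable"
    by (rule measurable_orthogonal_image[OF invT])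
  have "emeasure (distr lborel borel T) (box l u) = emeasure lborel (T -` box l u)"
    by (simp add: emeasure_distr)
  \<comment> \<open>Being Borel, the preimage has the same measure under \<open>lborel\<close> and
    \<open>lebesgue\<close>; invariance is applied for the latter.\<close>
  also have "T -` box l u \<in> sets borel"
    using measurable_sets_borel[of T borel "box l u"] by simp
  then have "emeasure lborel (T -` box l u) = emeasure lebesgue (inv T ` box l u)"
    using bij by (simp add: bij_vimage_eq_inv_image)
  also have "\<dots> = measure lebesgue (inv T ` box l u)"
    using m by (simp add: emeasure_eq_measure2)
  also have "measure lebesgue (inv T ` box l u) = measure lebesgue (box l u)"
    by (rule measure_orthogonal_image[OF invT]) simp
  also have "\<dots> = emeasure lborel (box l u)"
    using emeasure_lborel_box_finite[of l u] by (subst emeasure_eq_ennreal_measure) auto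
  finally show "emeasure (distr lborel borel T) (box l u) = (\<Prod>b\<in>Basis. (u - l) \<bullet> b)"
    by (simp add: emeasure_lborel_box_eq \<open>\<And>b. b \<in> Basis \<Longrightarrow> l \<bullet> b \<le> u \<bullet> b\<close>)
qed simp

lemma emeasure_lborel_Times:
  fixes A :: "'a::euclidean_space set" and B :: "'b::euclidean_space set"
  assumes "A \<in> sets borel" and "B \<in> sets borel"
  shows "emeasure lborel (A \<times> B) = emeasure lborel A * emeasure lborel B"
  unfolding lborel_prod[symmetric] using assms by (simp add: lborel.emeasure_pair_measure_Times)

lemma prod_UNIV_3: "(\<Prod>i\<in>(UNIV::3 set). f i) = f 1 * f 2 * (f 3 :: 'a::comm_monoid_mult)"
  unfolding UNIV_3 by (simp add: ac_simps)

lemma prod_Basis_cart: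
  fixes f :: "real^'n \<Rightarrow> 'a::comm_monoid_mult"
  shows "(\<Prod>b\<in>Basis. f b) = (\<Prod>i\<in>UNIV. f (axis i 1))"
proof -
  have B: "(Basis :: (real^'n) set) = range (\<lambda>i. axis i 1)"
    by (auto simp: Basis_vec_def)
  have inj: "inj (\<lambda>i. axis i 1 :: real^'n)"
    by (auto simp: inj_on_def axis_eq_axis)
  show ?thesis
    unfolding B by (simp add: prod.reindex[OF inj])
qed

text \<open>A linear change of variables as an identity of measures, checked on boxes. The density
  is the Jacobian of stretching two axes by \<open>s\<close>; it is applied with
  \<open>s = sqrt h\<close>.\<close>

lemma lborel_vec3_eq_density:
  fixes s :: real
  assumes "s > 0"
  defines "V \<equiv> (\<lambda>(a, b, c). a *\<^sub>R axis 1 1 + (s * b) *\<^sub>R axis 2 1 + (s * c) *\<^sub>R axis 3 1 :: real^3)"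
  shows "lborel = density (distr lborel borel V) (\<lambda>_. ennreal (s\<^sup>2))"
proof (rule lborel_eqI)
  have [measurable]: "V \<in> borel_measurable borel"
    unfolding V_def split_def
    by (intro borel_measurable_continuous_onI continuous_intros)
  fix l u :: "real^3"
  assume le: "\<And>b. b \<in> Basis \<Longrightarrow> l \<bullet> b \<le> u \<bullet> b"
  have le': "l $ i \<le> u $ i" for i
    using le[of "axis i 1"] by (simp add: inner_axis)
  have nn: "0 \<le> u$1 - l$1" "0 \<le> u$2/s - l$2/s" "0 \<le> u$3/s - l$3/s"
    using \<open>s > 0\<close> le' by (auto intro: divide_right_mono)
  have vimage: "V -` box l u = {l$1<..<u$1} \<times> {l$2/s<..<u$2/s} \<times> {l$3/s<..<u$3/s}"
    using \<open>s > 0\<close> by (auto simp: V_def mem_box_cart forall_3 axis_def field_simps)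
  have "emeasure lborel (V -` box l u) = ennreal (u$1 - l$1) * (ennreal (u$2/s - l$2/s) * ennreal (u$3/s - l$3/s))"
    unfolding vimage using \<open>s > 0\<close> le' by (simp add: emeasure_lborel_Times divide_right_mono borel_Times)
  moreover have "emeasure (density (distr lborel borel V) (\<lambda>_. ennreal (s\<^sup>2))) (box l u)
      = ennreal (s\<^sup>2) * emeasure lborel (V -` box l u)"
    by (simp add: emeasure_density_const emeasure_distr)
  ultimately have emeasure_eq: "emeasure (density (distr lborel borel V) (\<lambda>_. ennreal (s\<^sup>2))) (box l u)
      = ennreal (s\<^sup>2) * (ennreal (u$1 - l$1) * (ennreal (u$2/s - l$2/s) * ennreal (u$3/s - l$3/s)))"
    by (simp only:)
  have "(\<Prod>b\<in>Basis. (u - l) \<bullet> b) = (u$1 - l$1) * (u$2 - l$2) * (u$3 - l$3)"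
    by (simp add: prod_Basis_cart prod_UNIV_3 inner_axis)
  then have prod_eq: "(\<Prod>b\<in>Basis. (u - l) \<bullet> b) = s\<^sup>2 * ((u$1 - l$1) * ((u$2/s - l$2/s) * (u$3/s - l$3/s)))"
    using \<open>s > 0\<close> by (simp add: power2_eq_square flip: diff_divide_distrib)
  show "emeasure (density (distr lborel borel V) (\<lambda>_. ennreal (s\<^sup>2))) (box l u) = (\<Prod>b\<in>Basis. (u - l) \<bullet> b)"
    unfolding emeasure_eq prod_eq
    by (simp only: ennreal_mult nn mult_nonneg_nonneg zero_le_power2)
qed simp

section \<open>Product, exponential and Gaussian integrals\<close>

lemma
  fixes f :: "'a::euclidean_space \<Rightarrow> real" and g :: "'b::euclidean_space \<Rightarrow> real"
  assumes f: "integrable lborel f" and g: "integrable lborel g"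
  shows integrable_lborel_mult: "integrable lborel (\<lambda>(x, y). f x * g y)"
    and integral_lborel_mult:
      "(LINT z|lborel. (case z of (x, y) \<Rightarrow> f x * g y)) = (LINT x|lborel. f x) * (LINT y|lborel. g y)"
proof -
  have [measurable]: "f \<in> borel_measurable borel" "g \<in> borel_measurable borel"
    using f g by auto
  have *: "integrable (lborel \<Otimes>\<^sub>M lborel) (\<lambda>(x, y). f x * g y)"
  proof (rule lborel_pair.Fubini_integrable)
    show "integrable lborel (\<lambda>x. LINT y|lborel. norm (case (x, y) of (x, y) \<Rightarrow> f x * g y))"
      using f by (simp add: abs_mult)
  qed (use f g in auto)
  then show "integrable lborel (\<lambda>(x, y). f x * g y)"
    by (simp add: lborel_prod)
  show "(LINT z|lborel. (case z of (x, y) \<Rightarrow> f x * g y)) = (LINT x|lborel. f x) * (LINT y|lborel. g y)"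
    using lborel_pair.integral_fst'[OF *] by (simp add: lborel_prod)
qed

lemma integrable_exp_neg_abs:
  fixes k :: real
  assumes "k > 0"
  shows "integrable lborel (\<lambda>x. exp (- k * \<bar>x\<bar>))"
proof -
  let ?g = "\<lambda>x. indicator {0<..} x *\<^sub>R exp (- (x * k)) :: real"
  have g: "integrable lborel ?g"
    using integrable_I0i_exp_mscale[OF assms] by (simp add: set_integrable_def)
  \<comment> \<open>The half-line exponential plus its reflection. The sum is wrong only at 0, where
    both indicators vanish.\<close>
  have "integrable lborel (\<lambda>x. ?g x + ?g (0 + (-1) * x))"
    by (rule Bochner_Integration.integrable_add[OF g lborel_integrable_real_affine[OF g]]) simp
  moreover have "AE x in lborel. ?g x + ?g (0 + (-1) * x) = exp (- k * \<bar>x\<bar>)"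
    using AE_lborel_singleton[of "0::real"]
    by eventually_elim (auto simp: indicator_def mult.commute)
  ultimately show ?thesis
    by (subst integrable_cong_AE[symmetric]) (auto intro: borel_measurable_integrable)
qed

lemma
  fixes \<alpha> :: real
  assumes "\<alpha> > 0"
  shows integrable_gaussian: "integrable lborel (\<lambda>x. exp (- \<alpha> * x\<^sup>2))"
    and integral_gaussian: "(LINT x|lborel. exp (- \<alpha> * x\<^sup>2)) = sqrt (pi / \<alpha>)"
proof -
  \<comment> \<open>The standard deviation for which the normal density has exponent
    \<open>- \<alpha> * x\<^sup>2\<close>.\<close>
  define \<sigma> where "\<sigma> = 1 / sqrt (2 * \<alpha>)"
  have "\<sigma> > 0" and \<sigma>: "\<sigma>\<^sup>2 = 1 / (2 * \<alpha>)"
    using assms by (auto simp: \<sigma>_def power_divide)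
  have eq: "exp (- \<alpha> * x\<^sup>2) = sqrt (pi / \<alpha>) * normal_density 0 \<sigma> x" for x
    using assms by (simp add: normal_density_def \<sigma>)
  show "integrable lborel (\<lambda>x. exp (- \<alpha> * x\<^sup>2))" "(LINT x|lborel. exp (- \<alpha> * x\<^sup>2)) = sqrt (pi / \<alpha>)"
    unfolding eq using \<open>\<sigma> > 0\<close> by auto
qed

section \<open>Asymptotics of the integral\<close>

lemma borel_measurable_sinh_cosh [measurable (raw)]:
  fixes f :: "'a \<Rightarrow> real"
  assumes "f \<in> borel_measurable M"
  shows "(\<lambda>x. sinh (f x)) \<in> borel_measurable M" "(\<lambda>x. cosh (f x)) \<in> borel_measurable M"
  using assms
  by (auto intro!: measurable_compose[OF assms] borel_measurable_continuous_onI continuous_intros)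

lemma sinh_ge_self:
  fixes x :: real
  assumes "x \<ge> 0"
  shows "x \<le> sinh x"
proof -
  have "sinh 0 - 0 \<le> sinh x - x"
  proof (rule DERIV_nonneg_imp_nondecreasing[OF assms])
    fix y :: real assume "0 \<le> y" "y \<le> x"
    then show "\<exists>d. ((\<lambda>x. sinh x - x) has_real_derivative d) (at y) \<and> 0 \<le> d"
      by (intro exI[of _ "cosh y - 1"]) (auto intro!: derivative_eq_intros simp: cosh_real_ge_1)
  qed
  then show ?thesis by simp
qed

lemma mult_cosh_minus_sinh_nonneg:
  fixes x :: real
  assumes "x \<ge> 0"
  shows "0 \<le> x * cosh x - sinh x"
proof -
  have "0 * cosh 0 - sinh 0 \<le> x * cosh x - sinh x"
  proof (rule DERIV_nonneg_imp_nondecreasing[OF assms])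
    fix y :: real assume "0 \<le> y" "y \<le> x"
    then show "\<exists>d. ((\<lambda>x. x * cosh x - sinh x) has_real_derivative d) (at y) \<and> 0 \<le> d"
      by (intro exI[of _ "y * sinh y"]) (auto intro!: derivative_eq_intros)
  qed
  then show ?thesis by simp
qed

text \<open>Division by \<open>x\<^sup>2 * sinh x\<close> turns this into a lower bound for
  \<open>(x * coth x - 1) / x\<^sup>2\<close> of the right order at both ends: that quotient tends
  to 1/3 at 0 and behaves like \<open>1 / x\<close> at infinity.\<close>

lemma mult_cosh_minus_sinh_lower_bound:
  fixes x :: real
  assumes "x \<ge> 0"
  shows "x\<^sup>2 * sinh x / 3 \<le> (1 + x) * (x * cosh x - sinh x)"
proof -
  let ?f = "\<lambda>x::real. (1 + x) * (x * cosh x - sinh x) - x\<^sup>2 * sinh x / 3"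
  have "?f 0 \<le> ?f x"
  proof (rule DERIV_nonneg_imp_nondecreasing[OF assms])
    fix y :: real assume y: "0 \<le> y" "y \<le> x"
    let ?d = "(y * cosh y - sinh y) + (1 + y) * (y * sinh y) - (2 * y * sinh y + y\<^sup>2 * cosh y) / 3"
    have "(?f has_real_derivative ?d) (at y)"
      by (auto intro!: derivative_eq_intros simp: field_simps power2_eq_square)
    moreover have "?d \<ge> 0"
    proof -
      \<comment> \<open>This removes \<open>cosh\<close> from the subtracted term. The leftover
        \<open>y\<^sup>2 / 3\<close> is absorbed by a third of \<open>y * sinh y\<close>.\<close>
      have "cosh y = sinh y + exp (- y)"
        using cosh_minus_sinh[of y] by simp
      with y have "cosh y \<le> sinh y + 1" by simp
      then have "y\<^sup>2 * cosh y \<le> y\<^sup>2 * (sinh y + 1)"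
        by (intro mult_left_mono) auto
      moreover have "y\<^sup>2 \<le> y * sinh y"
        using y sinh_ge_self[OF y(1)] by (simp add: power2_eq_square mult_left_mono)
      moreover have "0 \<le> y\<^sup>2 * sinh y" using y by simp
      ultimately have "0 \<le> (y * cosh y - sinh y) + (y * sinh y + y\<^sup>2 * sinh y)
          - (2 * (y * sinh y) + y\<^sup>2 * cosh y) / 3"
        using mult_cosh_minus_sinh_nonneg[OF y(1)] unfolding distrib_left mult_1_right by argo
      also have "\<dots> = ?d"
        by (simp add: algebra_simps power2_eq_square)
      finally show ?thesis .
    qed
    ultimately show "\<exists>d. (?f has_real_derivative d) (at y) \<and> 0 \<le> d" by blast
  qed
  then show ?thesis by simp
qed

text \<open>The duplication formula for \<open>sinh\<close>, with
  \<open>x/2 \<le> sinh (x/2)\<close> cancelling the numerator and \<open>cosh (x/2)\<close>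
  supplying the exponential. Half of the decay rate is given up to absorb the factor
  \<open>x\<close>.\<close>

lemma div_sinh_le:
  fixes x :: real
  assumes "x > 0"
  shows "x / sinh x \<le> 2 * exp (- x / 2)"
proof -
  have "exp (x/2) / 2 \<le> cosh (x/2)"
    by (simp add: cosh_field_def)
  then have "2 * (x/2) * (exp (x/2) / 2) \<le> 2 * sinh (x/2) * cosh (x/2)"
    using assms sinh_ge_self[of "x/2"] by (intro mult_mono) auto
  also have "\<dots> = sinh x"
    using sinh_double[of "x/2"] by simp
  finally show ?thesis
    using assms by (simp add: field_simps exp_minus)
qed

section \<open>The rescaled integrand and its limit\<close>

text \<open>In the heat kernel exponent this multiplies \<open>|x|^2\<close> times the squared
  length of the part of \<open>l\<close> orthogonal to \<open>x\<close>. At \<open>r = 0\<close> the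
  convention for division gives 0, whereas the continuous extension has value 1/3.\<close>

definition transverse_rate :: "real \<Rightarrow> real" where
  "transverse_rate r = (r * coth r - 1) / r\<^sup>2"

lemma transverse_rate_eq: "r \<noteq> 0 \<Longrightarrow> transverse_rate r = (r * cosh r - sinh r) / (r\<^sup>2 * sinh r)"
  by (simp add: transverse_rate_def coth_def field_simps)

lemma transverse_rate_ge:
  assumes "r > 0"
  shows "1 / (3 * (1 + r)) \<le> transverse_rate r"
  using mult_cosh_minus_sinh_lower_bound[of r] assms
  by (simp add: transverse_rate_eq field_simps)

lemma transverse_rate_pos: "r > 0 \<Longrightarrow> 0 < transverse_rate r"
  by (rule less_le_trans[OF _ transverse_rate_ge]) auto

lemma borel_measurable_transverse_rate [measurable]: "transverse_rate \<in> borel_measurable borel"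
  unfolding transverse_rate_def[abs_def] coth_def by measurable

text \<open>The heat kernel integrand at time \<open>h\<close> after the substitution \<open>l = T (a, sqrt h b, sqrt h c)\<close>, where
  the rotation \<open>T\<close> takes the first axis to the direction of \<open>x\<close> and \<open>X = |x|^2\<close>; the factor
  \<open>exp (- X / (4 h))\<close> and the Jacobian \<open>h\<close> are split off.\<close>

definition scaled_integrand :: "real \<Rightarrow> real \<Rightarrow> real \<times> real \<times> real \<Rightarrow> real" where
  "scaled_integrand X h = (\<lambda>(a, b, c). let r = sqrt (a\<^sup>2 + h * (b\<^sup>2 + c\<^sup>2)) in
     r / sinh r * exp (- (X / 4) * (transverse_rate r * (b\<^sup>2 + c\<^sup>2))))"

lemma borel_measurable_scaled_integrand [measurable]: "scaled_integrand X h \<in> borel_measurable borel"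
  unfolding scaled_integrand_def split_def Let_def borel_prod[symmetric] by measurable

text \<open>A majorant independent of \<open>h\<close>, for dominated convergence, and a product in
  \<open>a\<close>, \<open>b\<close>, \<open>c\<close>, so that its integrability is elementary.
  Since the transverse rate may decay like \<open>1 / r\<close> while \<open>r\<close> can be
  comparable to \<open>t\<close>, the bound is only exponential in \<open>b\<close> and
  \<open>c\<close>.\<close>

lemma scaled_integrand_bound:
  fixes a b c :: real
  assumes X: "X > 0" and h: "0 \<le> h" "h \<le> 1"
  defines "\<kappa> \<equiv> X / (24 * (1 + X))"
  shows "\<bar>scaled_integrand X h (a, b, c)\<bar>
    \<le> 2 * exp (1/12) * exp (- (1/4) * \<bar>a\<bar>) * (exp (- \<kappa> * \<bar>b\<bar>) * exp (- \<kappa> * \<bar>c\<bar>))"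
proof -
  define r where "r = sqrt (a\<^sup>2 + h * (b\<^sup>2 + c\<^sup>2))"
  define t where "t = sqrt (b\<^sup>2 + c\<^sup>2)"
  \<comment> \<open>Weight for the estimate \<open>t^2 / (1 + r) \<ge> 2 \<theta> t - \<theta>^2 (1 + r)\<close>. It makes \<open>X \<theta>^2 \<le> 1\<close>, so that the
    loss in \<open>\<bar>a\<bar>\<close> is absorbed by \<open>exp (- r / 2)\<close>.\<close>
  define \<theta> where "\<theta> = 1 / (1 + X)"
  have t2: "t\<^sup>2 = b\<^sup>2 + c\<^sup>2" and "t \<ge> 0" by (auto simp: t_def)
  have G: "scaled_integrand X h (a, b, c) = r / sinh r * exp (- (X / 4) * (transverse_rate r * t\<^sup>2))"
    by (simp add: scaled_integrand_def r_def t2 Let_def)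
  have "r \<ge> 0" using h by (simp add: r_def)
  show ?thesis
  proof (cases "r = 0")
    \<comment> \<open>Here \<open>0 / sinh 0\<close> evaluates to 0, so the integrand
      vanishes.\<close>
    case True
    then show ?thesis by (simp add: G)
  next
    case False
    with \<open>r \<ge> 0\<close> have "r > 0" by simp
    have ra: "\<bar>a\<bar> \<le> r"
      using h unfolding r_def by (intro real_le_rsqrt) auto
    \<comment> \<open>The restriction \<open>h \<le> 1\<close> enters here.\<close>
    have "r \<le> sqrt (a\<^sup>2 + t\<^sup>2)"
      unfolding r_def t2 using h by (simp add: mult_left_le_one_le)
    also have "\<dots> \<le> \<bar>a\<bar> + t"
      using sqrt_sum_squares_le_sum_abs[of a t] \<open>t \<ge> 0\<close> by simp
    finally have rt: "r \<le> \<bar>a\<bar> + t" .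
    have \<theta>: "0 < \<theta>" "\<theta> \<le> 1" "X * \<theta>\<^sup>2 \<le> 1"
    proof -
      show "0 < \<theta>" "\<theta> \<le> 1" using X by (auto simp: \<theta>_def)
      have "X * \<theta> \<le> 1" using X by (simp add: \<theta>_def)
      then show "X * \<theta>\<^sup>2 \<le> 1"
        using mult_mono[OF \<open>X * \<theta> \<le> 1\<close> \<open>\<theta> \<le> 1\<close>] \<open>0 < \<theta>\<close> by (simp add: power2_eq_square mult.assoc)
    qed
    have "0 \<le> (t - \<theta> * (1 + r))\<^sup>2" by simp
    then have "(2 * \<theta> * t - \<theta>\<^sup>2 * (1 + r)) * (1 + r) \<le> t\<^sup>2"
      by (simp add: power2_eq_square algebra_simps)
    then have "2 * \<theta> * t - \<theta>\<^sup>2 * (1 + r) \<le> t\<^sup>2 / (1 + r)"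
      using \<open>r > 0\<close> by (simp add: pos_le_divide_eq)
    moreover have "\<theta>\<^sup>2 * (1 + r) \<le> \<theta>\<^sup>2 * (1 + \<bar>a\<bar> + t)"
      using rt by (intro mult_left_mono) auto
    moreover have "\<theta>\<^sup>2 * t \<le> \<theta> * t"
      using \<theta> \<open>t \<ge> 0\<close> by (simp add: power2_eq_square mult_right_mono mult_left_le_one_le)
    ultimately have "\<theta> * t - \<theta>\<^sup>2 * (1 + \<bar>a\<bar>) \<le> t\<^sup>2 / (1 + r)"
      by (simp add: algebra_simps)
    also have "\<dots> \<le> 3 * (transverse_rate r * t\<^sup>2)"
      using mult_right_mono[OF transverse_rate_ge[OF \<open>r > 0\<close>], of "3 * t\<^sup>2"] \<open>r > 0\<close>
      by (simp add: field_simps)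
    finally have "X * (\<theta> * t - \<theta>\<^sup>2 * (1 + \<bar>a\<bar>)) \<le> X * (3 * (transverse_rate r * t\<^sup>2))"
      using X by (intro mult_left_mono) auto
    moreover have "X * \<theta>\<^sup>2 * (1 + \<bar>a\<bar>) \<le> 1 + \<bar>a\<bar>"
      using \<theta> X by (intro mult_left_le_one_le) auto
    ultimately have *: "X * \<theta> * t - (1 + \<bar>a\<bar>) \<le> 3 * X * (transverse_rate r * t\<^sup>2)"
      by (simp add: algebra_simps)
    have "\<bar>b\<bar> \<le> t" "\<bar>c\<bar> \<le> t"
      by (auto simp: t_def intro!: real_le_rsqrt)
    \<comment> \<open>The 24 in \<open>\<kappa>\<close> is 4 from the exponent, times 3 from
      \<open>transverse_rate_ge\<close>, times 2 from
      \<open>\<bar>b\<bar> + \<bar>c\<bar> \<le> 2 * t\<close>.\<close>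
    then have "2 * \<kappa> * ((\<bar>b\<bar> + \<bar>c\<bar>) / 2) \<le> 2 * \<kappa> * t"
      using X by (intro mult_left_mono) (auto simp: \<kappa>_def)
    moreover have "X * \<theta> = 24 * \<kappa>"
      using X by (simp add: \<kappa>_def \<theta>_def divide_simps)
    ultimately have "12 * (\<kappa> * \<bar>b\<bar> + \<kappa> * \<bar>c\<bar>) \<le> X * \<theta> * t"
      by (simp add: algebra_simps)
    \<comment> \<open>The loss \<open>\<bar>a\<bar> / 12\<close> is paid by
      \<open>r / 2 \<ge> \<bar>a\<bar> / 2\<close>, leaving 5/12, more than the claimed 1/4.\<close>
    with * have exponent: "- (X / 4) * (transverse_rate r * t\<^sup>2) - r / 2
        \<le> 1/12 - 1/4 * \<bar>a\<bar> - \<kappa> * \<bar>b\<bar> - \<kappa> * \<bar>c\<bar>"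
      using ra by (simp add: algebra_simps)
    have "\<bar>scaled_integrand X h (a, b, c)\<bar> = r / sinh r * exp (- (X / 4) * (transverse_rate r * t\<^sup>2))"
      using \<open>r > 0\<close> by (simp add: G abs_mult)
    also have "\<dots> \<le> 2 * exp (- r / 2) * exp (- (X / 4) * (transverse_rate r * t\<^sup>2))"
      using div_sinh_le[OF \<open>r > 0\<close>] by (intro mult_right_mono) auto
    also have "\<dots> = 2 * exp (- (X / 4) * (transverse_rate r * t\<^sup>2) - r / 2)"
      by (simp add: mult.assoc flip: exp_add)
    also have "\<dots> \<le> 2 * exp (1/12 - 1/4 * \<bar>a\<bar> - \<kappa> * \<bar>b\<bar> - \<kappa> * \<bar>c\<bar>)"
      using exponent by simp
    also have "\<dots> = 2 * exp (1/12) * exp (- (1/4) * \<bar>a\<bar>) * (exp (- \<kappa> * \<bar>b\<bar>) * exp (- \<kappa> * \<bar>c\<bar>))"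
      by (simp add: mult.assoc flip: exp_add)
    finally show ?thesis .
  qed
qed

text \<open>For \<open>a \<noteq> 0\<close> the radius tends to \<open>\<bar>a\<bar> > 0\<close>,
  away from the removable singularity, so the limit is obtained by setting \<open>h = 0\<close>. The
  excluded plane is a null set.\<close>

lemma tendsto_scaled_integrand:
  assumes "a \<noteq> 0"
  shows "((\<lambda>h. scaled_integrand X h (a, b, c)) \<longlongrightarrow> scaled_integrand X 0 (a, b, c)) (at_right 0)"
proof -
  have r: "((\<lambda>h. sqrt (a\<^sup>2 + h * (b\<^sup>2 + c\<^sup>2))) \<longlongrightarrow> sqrt (a\<^sup>2 + 0 * (b\<^sup>2 + c\<^sup>2))) (at_right 0)"
    by (intro tendsto_intros)
  have "isCont (\<lambda>r. r / sinh r * exp (- (X / 4) * (transverse_rate r * (b\<^sup>2 + c\<^sup>2)))) \<bar>a\<bar>"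
    unfolding transverse_rate_def coth_def using assms by (intro continuous_intros) auto
  from isCont_tendsto_compose[OF this] r show ?thesis
    by (simp add: scaled_integrand_def Let_def)
qed

lemma AE_lborel_fst_neq_0: "AE p in lborel. fst (p :: real \<times> 'a::euclidean_space) \<noteq> 0"
proof -
  have "{p. fst p = 0} = {0::real} \<times> (UNIV :: 'a set)" by auto
  moreover have "emeasure lborel ({0::real} \<times> (UNIV :: 'a set)) = 0"
    by (subst emeasure_lborel_Times) auto
  ultimately show ?thesis
    by (intro AE_I[of _ _ "{p. fst p = 0}"]) (auto simp: borel_Times)
qed

lemma
  assumes X: "X > 0"
  shows integrable_scaled_integrand_0: "integrable lborel (scaled_integrand X 0)"
    and tendsto_integral_scaled_integrand:
      "((\<lambda>h. LINT p|lborel. scaled_integrand X h p) \<longlongrightarrow> (LINT p|lborel. scaled_integrand X 0 p)) (at_right 0)"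
proof -
  define \<kappa> where "\<kappa> = X / (24 * (1 + X))"
  define w where "w = (\<lambda>(a, y). 2 * exp (1/12) * exp (- (1/4) * \<bar>a\<bar>) *
      (case y of (b, c) \<Rightarrow> exp (- \<kappa> * \<bar>b\<bar>) * exp (- \<kappa> * \<bar>c\<bar>)) :: real)"
  have "\<kappa> > 0" using X by (simp add: \<kappa>_def)
  have w: "integrable lborel w"
    unfolding w_def
    by (intro integrable_lborel_mult integrable_mult_right integrable_exp_neg_abs \<open>\<kappa> > 0\<close>) auto
  have bound: "norm (scaled_integrand X h p) \<le> w p" if "0 \<le> h" "h \<le> 1" for h p
    using scaled_integrand_bound[OF X that] by (cases p) (simp add: w_def \<kappa>_def)
  show "integrable lborel (scaled_integrand X 0)"
  proof (rule Bochner_Integration.integrable_bound[OF w])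
    show "AE p in lborel. norm (scaled_integrand X 0 p) \<le> norm (w p)"
      using bound[of 0] by (intro AE_I2) (metis abs_ge_self order_refl order_trans real_norm_def zero_le_one)
  qed simp
  \<comment> \<open>Dominated convergence is applied along \<open>at_top\<close> in
    \<open>u = 1 / h\<close>; the majorant is valid once \<open>u \<ge> 1\<close>.\<close>
  have "((\<lambda>u. LINT p|lborel. scaled_integrand X (inverse u) p) \<longlongrightarrow> (LINT p|lborel. scaled_integrand X 0 p)) at_top"
  proof (rule integral_dominated_convergence_at_top[OF _ _ w])
    show "AE p in lborel. ((\<lambda>u. scaled_integrand X (inverse u) p) \<longlongrightarrow> scaled_integrand X 0 p) at_top"
      using AE_lborel_fst_neq_0
    proof eventually_elim
      fix p :: "real \<times> real \<times> real"
      assume "fst p \<noteq> 0"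
      then show "((\<lambda>u. scaled_integrand X (inverse u) p) \<longlongrightarrow> scaled_integrand X 0 p) at_top"
        using tendsto_scaled_integrand[of "fst p" X "fst (snd p)" "snd (snd p)"]
        by (simp add: filterlim_at_right_to_top)
    qed
    show "\<forall>\<^sub>F u in at_top. AE p in lborel. norm (scaled_integrand X (inverse u) p) \<le> w p"
      using eventually_ge_at_top[of 1]
      by eventually_elim (rule AE_I2, rule bound, auto simp: inverse_le_1_iff)
  qed auto
  then show "((\<lambda>h. LINT p|lborel. scaled_integrand X h p) \<longlongrightarrow> (LINT p|lborel. scaled_integrand X 0 p)) (at_right 0)"
    by (simp add: filterlim_at_right_to_top)
qed

section \<open>Evaluation of the limit integral\<close>

text \<open>Numerator and denominator are both odd. This carries formulas for the positive radius
  \<open>\<bar>a\<bar>\<close> over to all \<open>a\<close>.\<close>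

lemma cube_div_cosh_sinh_abs:
  fixes a :: real
  shows "\<bar>a\<bar> ^ 3 / (\<bar>a\<bar> * cosh \<bar>a\<bar> - sinh \<bar>a\<bar>) = a ^ 3 / (a * cosh a - sinh a)"
proof (cases "a \<ge> 0")
  case False
  then have "\<bar>a\<bar> ^ 3 / (\<bar>a\<bar> * cosh \<bar>a\<bar> - sinh \<bar>a\<bar>) = - (a ^ 3) / - (a * cosh a - sinh a)"
    by simp
  then show ?thesis by (simp only: minus_divide_divide)
qed simp

text \<open>Fubini with the transverse plane integrated first. The Gaussian of rate
  \<open>\<alpha>\<close> contributes \<open>pi / \<alpha>\<close>, and the factor
  \<open>transverse_rate\<close> in \<open>\<alpha>\<close> turns
  \<open>\<bar>a\<bar> / sinh \<bar>a\<bar>\<close> into the integrand of F(0,0). Integrability of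
  the latter comes from Fubini as well.\<close>

lemma integral_scaled_integrand_0:
  assumes X: "X > 0"
  shows "integrable lborel (\<lambda>a::real. a ^ 3 / (a * cosh a - sinh a))" (is ?int)
    and "(LINT p|lborel. scaled_integrand X 0 p)
      = 4 * pi / X * (LINT a|lborel. a ^ 3 / (a * cosh a - sinh a))" (is ?eq)
proof -
  let ?F = "\<lambda>a::real. a ^ 3 / (a * cosh a - sinh a)"
  have inner: "(LINT y|lborel. scaled_integrand X 0 (a, y)) = 4 * pi / X * ?F a" if "a \<noteq> 0" for a
  proof -
    define \<alpha> where "\<alpha> = X / 4 * transverse_rate \<bar>a\<bar>"
    have "\<alpha> > 0" using X that transverse_rate_pos[of "\<bar>a\<bar>"] by (simp add: \<alpha>_def)
    have "scaled_integrand X 0 (a, y)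
        = \<bar>a\<bar> / sinh \<bar>a\<bar> * (case y of (b, c) \<Rightarrow> exp (- \<alpha> * b\<^sup>2) * exp (- \<alpha> * c\<^sup>2))" for y
      by (simp add: scaled_integrand_def Let_def split_def \<alpha>_def algebra_simps flip: exp_add)
    then have "(LINT y|lborel. scaled_integrand X 0 (a, y))
        = \<bar>a\<bar> / sinh \<bar>a\<bar> * (LINT y|lborel. (case y of (b, c) \<Rightarrow> exp (- \<alpha> * b\<^sup>2) * exp (- \<alpha> * c\<^sup>2)))"
      by (simp only: integral_mult_right_zero)
    also have "\<dots> = \<bar>a\<bar> / sinh \<bar>a\<bar> * (sqrt (pi / \<alpha>) * sqrt (pi / \<alpha>))"
      by (simp only: integral_lborel_mult[OF integrable_gaussian integrable_gaussian] integral_gaussian \<open>\<alpha> > 0\<close>)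
    also have "\<dots> = \<bar>a\<bar> / sinh \<bar>a\<bar> * (pi / \<alpha>)"
      using \<open>\<alpha> > 0\<close> by simp
    also have "\<dots> = 4 * pi / X * (\<bar>a\<bar> ^ 3 / (\<bar>a\<bar> * cosh \<bar>a\<bar> - sinh \<bar>a\<bar>))"
      using that by (simp add: \<alpha>_def transverse_rate_eq power2_eq_square power3_eq_cube)
    finally show ?thesis
      by (simp only: cube_div_cosh_sinh_abs)
  qed
  have G: "integrable (lborel \<Otimes>\<^sub>M lborel) (scaled_integrand X 0)"
    using integrable_scaled_integrand_0[OF X] by (simp add: lborel_prod)
  have AE: "AE a in lborel. (LINT y|lborel. scaled_integrand X 0 (a, y)) = 4 * pi / X * ?F a"
    using AE_lborel_singleton[of "0::real"] by eventually_elim (rule inner)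
  have I: "integrable lborel (\<lambda>a. LINT y|lborel. scaled_integrand X 0 (a, y))"
    by (rule lborel_pair.integrable_fst'[OF G])
  then have "integrable lborel (\<lambda>a. 4 * pi / X * ?F a)"
    by (subst (asm) integrable_cong_AE[OF borel_measurable_integrable[OF I] _ AE]) simp_all
  then show ?int
    using X by (subst (asm) integrable_mult_left_iff) auto
  have "(LINT p|lborel. scaled_integrand X 0 p) = (LINT a|lborel. LINT y|lborel. scaled_integrand X 0 (a, y))"
    using lborel_pair.integral_fst'[OF G] by (simp add: lborel_prod)
  also have "\<dots> = (LINT a|lborel. 4 * pi / X * ?F a)"
    by (rule integral_cong_AE[OF borel_measurable_integrable[OF I] _ AE]) simp
  finally show ?eq by (simp only: integral_mult_right_zero)
qed

text \<open>Needed to divide by the leading coefficient. A nonnegative function with zero integral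
  vanishes almost everywhere, which fails on the unit interval.\<close>

lemma integral_cube_div_pos: "0 < (LINT a|lborel. a ^ 3 / (a * cosh a - sinh a :: real))"
proof -
  let ?F = "\<lambda>a::real. a ^ 3 / (a * cosh a - sinh a)"
  have pos: "?F a > 0" if "a > 0" for a
  proof -
    have "0 < transverse_rate a" by (rule transverse_rate_pos[OF that])
    then show ?thesis using that by (auto simp: transverse_rate_eq zero_less_divide_iff mult_less_0_iff)
  qed
  have nonneg: "?F a \<ge> 0" for a
    using pos[of "\<bar>a\<bar>"] cube_div_cosh_sinh_abs[of a] by (cases "a = 0") auto
  have "(LINT a|lborel. ?F a) \<noteq> 0"
  proof
    assume "(LINT a|lborel. ?F a) = 0"
    then have "AE a in lborel. ?F a = 0"
      using integral_nonneg_eq_0_iff_AE[OF integral_scaled_integrand_0(1)[of 1]] nonneg by auto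
    then have "AE a in lborel. a \<notin> {0<..<1::real}"
      by eventually_elim (use pos in force)
    then have "emeasure lborel {0<..<1::real} = 0"
      by (subst (asm) AE_iff_measurable[of "{0<..<1}"]) auto
    then show False by simp
  qed
  moreover have "(LINT a|lborel. ?F a) \<ge> 0"
    using nonneg by (intro Bochner_Integration.integral_nonneg) auto
  ultimately show ?thesis by simp
qed

section \<open>Reduction of the heat kernel and conclusion\<close>

text \<open>An exact identity for every \<open>h > 0\<close>: rotate the first axis to the direction
  of \<open>x\<close>, then stretch the transverse coordinates by \<open>sqrt h\<close>. The
  Jacobian \<open>h\<close> is what raises the power from -9/2 to -7/2 in the end.\<close>

lemma heat_p_horizontal:
  fixes x :: "real^3"
  assumes "x \<noteq> 0" and "h > 0"
  shows "heat_p ((1 / sqrt h) *\<^sub>R x) 0 = complex_of_real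
    (h * exp (- (norm x)\<^sup>2 / (4 * h)) * (LINT p|lborel. scaled_integrand ((norm x)\<^sup>2) h p))"
proof -
  define y where "y = (1 / sqrt h) *\<^sub>R x"
  define f where "f l = norm l / sinh (norm l) * exp (- (1/4) * ((norm y)\<^sup>2 +
      transverse_rate (norm l) * ((norm l)\<^sup>2 * (norm y)\<^sup>2 - (l \<bullet> y)\<^sup>2)))" for l :: "real^3"
  have [measurable]: "f \<in> borel_measurable borel"
    unfolding f_def by measurable
  obtain T :: "real^3 \<Rightarrow> real^3" where T: "orthogonal_transformation T" and Tx: "T (norm x *\<^sub>R axis 1 1) = x"
    using orthogonal_transformation_exists[of "norm x *\<^sub>R axis 1 1" x] by (auto simp: norm_axis_1)
  define V where "V = (\<lambda>(a, b, c). a *\<^sub>R axis 1 1 + (sqrt h * b) *\<^sub>R axis 2 1 + (sqrt h * c) *\<^sub>R axis 3 1 :: real^3)"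
  have [measurable]: "V \<in> borel_measurable borel" "T \<in> borel_measurable borel"
  proof -
    show "V \<in> borel_measurable borel"
      unfolding V_def split_def by (intro borel_measurable_continuous_onI continuous_intros)
    show "T \<in> borel_measurable borel"
      by (rule borel_measurable_orthogonal_transformation[OF T])
  qed
  have fTV: "f (T (V p)) = exp (- (norm x)\<^sup>2 / (4 * h)) * scaled_integrand ((norm x)\<^sup>2) h p" for p
  proof -
    obtain a b c where p: "p = (a, b, c)" by (cases p) auto
    have n2: "(norm (V p))\<^sup>2 = a\<^sup>2 + h * (b\<^sup>2 + c\<^sup>2)"
      using \<open>h > 0\<close> unfolding power2_norm_eq_inner
      by (simp add: p V_def inner_vec_def sum_3 axis_def power2_eq_square algebra_simps)
    then have n: "norm (V p) = sqrt (a\<^sup>2 + h * (b\<^sup>2 + c\<^sup>2))"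
      by (metis norm_ge_zero real_sqrt_unique)
    have "T (V p) \<bullet> y = (1 / sqrt h) * (T (V p) \<bullet> T (norm x *\<^sub>R axis 1 1))"
      by (simp add: y_def Tx)
    also have "\<dots> = norm x * a / sqrt h"
      using T by (simp add: orthogonal_transformation_def p V_def inner_axis_axis inner_add_left)
    finally have ip: "(T (V p) \<bullet> y)\<^sup>2 = (norm x)\<^sup>2 * a\<^sup>2 / h"
      using \<open>h > 0\<close> by (simp add: power_divide power_mult_distrib)
    have y2: "(norm y)\<^sup>2 = (norm x)\<^sup>2 / h"
      using \<open>h > 0\<close> by (simp add: y_def power_divide)
    \<comment> \<open>The component along \<open>x\<close> cancels, and so do the powers of
      \<open>h\<close>; what remains of \<open>h\<close> in the transverse exponent sits in the
      radius.\<close>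
    have *: "(norm (V p))\<^sup>2 * ((norm x)\<^sup>2 / h) - (T (V p) \<bullet> y)\<^sup>2 = (norm x)\<^sup>2 * (b\<^sup>2 + c\<^sup>2)"
      unfolding n2 ip using \<open>h > 0\<close> by (simp add: field_simps)
    have "f (T (V p)) = norm (V p) / sinh (norm (V p)) * exp (- (1/4) * ((norm x)\<^sup>2 / h +
        transverse_rate (norm (V p)) * ((norm x)\<^sup>2 * (b\<^sup>2 + c\<^sup>2))))"
      unfolding f_def orthogonal_transformation_norm[OF T] y2 * ..
    also have "- (1/4) * ((norm x)\<^sup>2 / h + transverse_rate (norm (V p)) * ((norm x)\<^sup>2 * (b\<^sup>2 + c\<^sup>2)))
        = - (norm x)\<^sup>2 / (4 * h) + (- ((norm x)\<^sup>2 / 4) * (transverse_rate (norm (V p)) * (b\<^sup>2 + c\<^sup>2)))"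
      using \<open>h > 0\<close> by (simp add: field_simps)
    finally have "f (T (V p)) = exp (- (norm x)\<^sup>2 / (4 * h)) * (norm (V p) / sinh (norm (V p)) *
        exp (- ((norm x)\<^sup>2 / 4) * (transverse_rate (norm (V p)) * (b\<^sup>2 + c\<^sup>2))))"
      by (simp only: exp_add mult_ac)
    then show ?thesis
      unfolding n by (simp only: scaled_integrand_def p split Let_def)
  qed
  \<comment> \<open>For \<open>t = 0\<close> the oscillating factor is 1 and the integrand is
    real.\<close>
  have "heat_p y 0 = (LINT l|lborel. complex_of_real (f l))"
    unfolding heat_p_def f_def transverse_rate_def
    by (intro Bochner_Integration.integral_cong refl) (simp flip: exp_of_real)
  also have "\<dots> = complex_of_real (LINT l|lborel. f l)"
    by (rule integral_complex_of_real)
  also have "(LINT l|lborel. f l) = (LINT l|distr lborel borel T. f l)"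
    by (simp add: lborel_distr_orthogonal_transformation[OF T])
  also have "\<dots> = (LINT l|lborel. f (T l))"
    by (rule integral_distr) auto
  also have "\<dots> = (LINT l|density (distr lborel borel V) (\<lambda>_. ennreal ((sqrt h)\<^sup>2)). f (T l))"
    using lborel_vec3_eq_density[of "sqrt h"] \<open>h > 0\<close> unfolding V_def by simp
  also have "\<dots> = h * (LINT p|lborel. f (T (V p)))"
    using \<open>h > 0\<close> by (simp add: integral_density integral_distr)
  also have "\<dots> = h * exp (- (norm x)\<^sup>2 / (4 * h)) * (LINT p|lborel. scaled_integrand ((norm x)\<^sup>2) h p)"
    by (simp add: fTV)
  finally show ?thesis
    unfolding y_def .
qed

lemma bold_F_0: "bold_F 0 0 = complex_of_real (LINT r|lborel. r ^ 3 / (r * cosh r - sinh r))"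
  unfolding bold_F_def by (simp flip: integral_complex_of_real)

text \<open>The term o_g(1) is a real function \<open>\<epsilon>\<close> chosen for the given point,
  and the asymptotic formula becomes an exact equation for all \<open>h > 0\<close>.\<close>

theorem corollary11p6:
  fixes C :: real and x t :: "real^3"
  assumes "C > 0" and "x \<noteq> 0" and "t = 0"
  shows "\<exists>\<epsilon> :: real \<Rightarrow> real. (\<epsilon> \<longlongrightarrow> 0) (at_right 0) \<and>
    (\<forall>h>0. heat_kernel C h x t =
       complex_of_real (C * 4 * pi) * bold_F 0 0 *
       complex_of_real (h powr (- 7/2) * (1 / (norm x)\<^sup>2) * exp (- (cc_dist (x, t))\<^sup>2 / (4 * h)) *
         (1 + \<epsilon> h)))"
proof (intro exI conjI allI impI)
  define X where "X = (norm x)\<^sup>2"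
  have "X > 0" using \<open>x \<noteq> 0\<close> by (simp add: X_def)
  define F where "F = (LINT r|lborel. r ^ 3 / (r * cosh r - sinh r :: real))"
  have "F > 0" unfolding F_def by (rule integral_cube_div_pos)
  \<comment> \<open>\<open>J 0\<close> is the limit integral, so \<open>J h / J 0 - 1\<close> is the
    relative error and serves as \<open>\<epsilon>\<close>.\<close>
  define J where "J h = (LINT p|lborel. scaled_integrand X h p)" for h
  have J0: "J 0 = 4 * pi / X * F"
    using integral_scaled_integrand_0(2)[OF \<open>X > 0\<close>] by (simp add: J_def F_def)
  then have "J 0 > 0" using \<open>F > 0\<close> \<open>X > 0\<close> by simp
  have "((\<lambda>h. J h / J 0 - 1) \<longlongrightarrow> J 0 / J 0 - 1) (at_right 0)"
    using \<open>J 0 > 0\<close> tendsto_integral_scaled_integrand[OF \<open>X > 0\<close>, folded J_def]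
    by (intro tendsto_intros) auto
  then show "((\<lambda>h. J h / J 0 - 1) \<longlongrightarrow> 0) (at_right 0)"
    using \<open>J 0 > 0\<close> by simp
  fix h :: real assume "h > 0"
  have powr_h: "h powr (- 9/2) * h = h powr (- 7/2)"
    using \<open>h > 0\<close> powr_add[of h "- 9/2" 1] by simp
  have Jh: "4 * pi * F * (1 / X) * (1 + (J h / J 0 - 1)) = J h"
    using \<open>F > 0\<close> \<open>X > 0\<close> by (simp add: J0)
  have "C * h powr (- 9/2) * (h * exp (- X / (4 * h)) * J h)
      = C * (h powr (- 9/2) * h) * exp (- X / (4 * h)) * J h"
    by (simp only: mult_ac)
  also have "\<dots> = C * h powr (- 7/2) * exp (- X / (4 * h)) * (4 * pi * F * (1 / X) * (1 + (J h / J 0 - 1)))"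
    by (simp only: powr_h Jh)
  also have "\<dots> = C * 4 * pi * F * (h powr (- 7/2) * (1 / X) * exp (- X / (4 * h)) * (1 + (J h / J 0 - 1)))"
    by (simp only: mult_ac)
  finally have "C * h powr (- 9/2) * (h * exp (- X / (4 * h)) * J h) =
      C * 4 * pi * F * (h powr (- 7/2) * (1 / X) * exp (- X / (4 * h)) * (1 + (J h / J 0 - 1)))" .
  moreover have "heat_kernel C h x t = complex_of_real (C * h powr (- 9/2) * (h * exp (- X / (4 * h)) * J h))"
    using heat_p_horizontal[OF \<open>x \<noteq> 0\<close> \<open>h > 0\<close>] \<open>t = 0\<close>
    by (simp add: heat_kernel_def J_def X_def)
  ultimately show "heat_kernel C h x t = complex_of_real (C * 4 * pi) * bold_F 0 0 *
       complex_of_real (h powr (- 7/2) * (1 / (norm x)\<^sup>2) * exp (- (cc_dist (x, t))\<^sup>2 / (4 * h)) *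
         (1 + (J h / J 0 - 1)))"
    unfolding \<open>t = 0\<close> cc_dist_horizontal bold_F_0 F_def[symmetric] X_def[symmetric]
    by (simp only: of_real_mult)
qed

end
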